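(* Let $n\ge 2$, $m\ge 1$ and $d\in\{1,\dots,n-1\}$ be integers such that $m\in M(n,d)$, where $M(n,d)=\{k\ge 1 : \gcd(\ell,k)\le d \text{ for all integers } \ell \text{ with } 1<\ell\le n\}$, and assume that at least one process invokes $\mathsf{elect}()$ (participation of all the processes is not required). Then Algorithm 1 (given in the context) solves $d$-election in a fully anonymous system of $n$ processes and $m$ registers, where communication is through RMW registers.
   Context: System. There are $n$ asynchronous processes $p_1,\dots,p_n$ and $m$ shared atomic registers. An execution is an interleaving of atomic steps; in each step one process performs one operation on one register and updates its local state. Processes do not crash: every participating process that has not yet returned keeps taking steps; otherwise the interleaving is arbitrary. Algorithms may depend on $n,m,d$. RMW registers. The operations on a register $X$ are read, write, and $\mathsf{compare\&swap}(X,\mathrm{old},\mathrm{new})$, which atomically does the following: if $X=\mathrm{old}$ it assigns $\mathrm{new}$ to $X$ and returns true, otherwise it leaves $X$ unchanged and returns false. Full anonymity. The processes have no identities, run the same code and have the same initial local state (the subscript $i$ is only an external notation). The memory is anonymous: an adversary chooses, for each process $p_i$, a permutation $f_i$ of $\{1,\dots,m\}$, unknown to all the processes; when $p_i$ uses the name $R[x]$ (written $R_i[x]$) it accesses the register $R[f_i(x)]$. All registers have the same initial value. $d$-election. Each participating process invokes $\mathsf{elect}()$ (once), which returns either "leader" or "not leader"; a process that returns "leader" is elected. An algorithm solves $d$-election if in every execution, for every choice of the permutations $f_i$, every participating process eventually returns, and at least one and at most $d$ processes are elected. "Participation not required" means that an arbitrary nonempty subset of the processes may participate. Algorithm 1 (code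 of $\mathsf{elect}()$ for $p_i$; all shared registers are initially $0$; $counter_i$, $round_i$, $competitors_i$, $myview_i[1..m]$ are local variables): 1. $counter_i\leftarrow 0$; $round_i\leftarrow 0$; for each $j\in\{1,\dots,m\}$: $myview_i[j]\leftarrow$ false. 2. repeat 3. $\quad round_i\leftarrow round_i+1$; 4. $\quad$ for each $j\in\{1,\dots,m\}$: if $myview_i[j]$ then $R_i[j]\leftarrow round_i$; 5. $\quad$ for each $j\in\{1,\dots,m\}$ do 6. $\quad\quad$ while $R_i[j]<round_i$ do 7. $\quad\quad\quad myview_i[j]\leftarrow \mathsf{compare\&swap}(R_i[j],0,round_i)$; 8. $\quad\quad\quad$ if $myview_i[j]$ then $counter_i\leftarrow counter_i+1$; (end while; end for) 9. $\quad competitors_i\leftarrow n-round_i+1$; 10. $\quad$ if $counter_i< m/competitors_i$ (division of real numbers) then 11. $\quad\quad$ for each $j\in\{1,\dots,m\}$: if $myview_i[j]$ then $R_i[j]\leftarrow 0$; 12. $\quad\quad$ return "not leader"; (end if) 13. until $round_i=n-d+1$; 14. return "leader". *)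

theory Defs
  imports Complex_Main "HOL-Combinatorics.Permutations"
begin

section \<open>Fully anonymous systems with RMW registers\<close>

text \<open>
  Operations refer to registers by the name the invoking process uses for them;
  the names are \<open>1, \<dots>, m\<close>. In \<open>Compare_And_Swap x u v\<close>, \<open>u\<close> is the old value and \<open>v\<close> the new one.
\<close>

datatype 'v operation =
    Read nat
  | Write nat 'v
  | Compare_And_Swap nat 'v 'v

datatype 'v response = Val 'v | Ack | Outcome bool

datatype verdict = Leader | Not_Leader

datatype 'v action = Invoke "'v operation" | Return verdict

fun register_name :: "'v operation \<Rightarrow> nat" where
  "register_name (Read x) = x"
| "register_name (Write x v) = x"
| "register_name (Compare_And_Swap x u v) = x"

text \<open>
  A local state determines either the register operation the process performs in its next
  step or, if \<open>elect()\<close> has returned, the value returned. The local computation between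
  two register operations is part of the first of the two steps, and \<open>receive\<close> accounts
  for it. Neither component depends on the process or on its register permutation: all processes
  run the same code from the same initial local state.
\<close>

record ('s, 'v) algorithm =
  init_reg :: 'v
  init_state :: 's
  next_action :: "'s \<Rightarrow> 'v action"
  receive :: "'s \<Rightarrow> 'v response \<Rightarrow> 's"

record ('s, 'v) config =
  memory :: "nat \<Rightarrow> 'v"
  state :: "nat \<Rightarrow> 's"

text \<open>The argument \<open>g\<close> is the permutation that translates the names used by the invoking process.\<close>

fun perform :: "(nat \<Rightarrow> nat) \<Rightarrow> 'v operation \<Rightarrow> (nat \<Rightarrow> 'v) \<Rightarrow> (nat \<Rightarrow> 'v) \<times> 'v response" where
  "perform g (Read x) R = (R, Val (R (g x)))"
| "perform g (Write x v) R = (R(g x := v), Ack)"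
| "perform g (Compare_And_Swap x u v) R =
     (if R (g x) = u then (R(g x := v), Outcome True) else (R, Outcome False))"

definition initial_config :: "('s, 'v) algorithm \<Rightarrow> ('s, 'v) config" where
  "initial_config A = \<lparr>memory = (\<lambda>_. init_reg A), state = (\<lambda>_. init_state A)\<rparr>"

definition step ::
  "('s, 'v) algorithm \<Rightarrow> (nat \<Rightarrow> nat \<Rightarrow> nat) \<Rightarrow> nat \<Rightarrow> ('s, 'v) config \<Rightarrow> ('s, 'v) config \<Rightarrow> bool"
where
  "step A f i c c' \<longleftrightarrow>
     (\<exists>oper R' r. next_action A (state c i) = Invoke oper \<and>
        perform (f i) oper (memory c) = (R', r) \<and>
        c' = \<lparr>memory = R', state = (state c)(i := receive A (state c i) r)\<rparr>)"

definition returned :: "('s, 'v) algorithm \<Rightarrow> ('s, 'v) config \<Rightarrow> nat \<Rightarrow> bool" where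
  "returned A c i \<longleftrightarrow> (\<exists>v. next_action A (state c i) = Return v)"

text \<open>
  \<open>P\<close> is the set of participating processes, \<open>c t\<close> is the configuration after \<open>t\<close> steps, and
  \<open>s t = Some i\<close> says that the next step is taken by process \<open>i\<close>. An execution in which all
  participating processes return is finite; it is represented by an infinite sequence that
  repeats the last configuration, with \<open>s t = None\<close>. Apart from the last conjunct (no crashes), the
  interleaving is arbitrary.
\<close>

definition execution ::
  "('s, 'v) algorithm \<Rightarrow> nat set \<Rightarrow> (nat \<Rightarrow> nat \<Rightarrow> nat) \<Rightarrow>
   (nat \<Rightarrow> ('s, 'v) config) \<Rightarrow> (nat \<Rightarrow> nat option) \<Rightarrow> bool"
where
  "execution A P f c s \<longleftrightarrow>
     c 0 = initial_config A \<and>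
     (\<forall>t. case s t of
            Some i \<Rightarrow> i \<in> P \<and> step A f i (c t) (c (Suc t))
          | None \<Rightarrow> (\<forall>i\<in>P. returned A (c t) i) \<and> c (Suc t) = c t) \<and>
     (\<forall>i\<in>P. \<forall>t. \<not> returned A (c t) i \<longrightarrow> (\<exists>t'\<ge>t. s t' = Some i))"

definition elected :: "('s, 'v) algorithm \<Rightarrow> nat set \<Rightarrow> (nat \<Rightarrow> ('s, 'v) config) \<Rightarrow> nat set" where
  "elected A P c = {i \<in> P. \<exists>t. next_action A (state (c t) i) = Return Leader}"

text \<open>
  Participation is not required: \<open>P\<close> is an arbitrary nonempty set of processes. The first
  conjunct of the conclusion says that the algorithm uses only the \<open>m\<close> registers of the system;
  \<open>memory\<close> is a total function on \<open>nat\<close>.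
\<close>

definition solves_d_election :: "nat \<Rightarrow> nat \<Rightarrow> nat \<Rightarrow> ('s, 'v) algorithm \<Rightarrow> bool" where
  "solves_d_election n m d A \<longleftrightarrow>
     (\<forall>P f c s. P \<noteq> {} \<and> P \<subseteq> {1..n} \<and> (\<forall>i\<in>{1..n}. f i permutes {1..m}) \<and> execution A P f c s \<longrightarrow>
        (\<forall>i\<in>P. \<forall>t oper. next_action A (state (c t) i) = Invoke oper \<longrightarrow> register_name oper \<in> {1..m}) \<and>
        (\<forall>i\<in>P. \<exists>t. returned A (c t) i) \<and>
        1 \<le> card (elected A P c) \<and> card (elected A P c) \<le> d)"


section \<open>The algorithm\<close>

text \<open>
  The control locations are the register operations in the code, together with the loop index,
  and the return. \<open>Raise j\<close> is the write of the round number to a register already owned,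
  \<open>Test j\<close> is the read in the guard of the while loop, \<open>Claim j\<close> is the compare\&swap,
  and \<open>Release j\<close> is the write of \<open>0\<close>. All loops over \<open>{1..m}\<close> run in increasing order.
\<close>

datatype location = Raise nat | Test nat | Claim nat | Release nat | Returned verdict

record local_state =
  counter :: nat
  round_no :: nat
  myview :: "nat \<Rightarrow> bool"
  location :: location

text \<open>
  Here \<open>find\<close> skips the indices \<open>k\<close> with \<open>\<not> myview k\<close>, for which the loop body performs no
  register operation.
\<close>

definition raise_from :: "nat \<Rightarrow> nat \<Rightarrow> local_state \<Rightarrow> local_state" where
  "raise_from m j s =
     (case find (myview s) [j..<Suc m] of
        Some k \<Rightarrow> s\<lparr>location := Raise k\<rparr>
      | None \<Rightarrow> s\<lparr>location := Test 1\<rparr>)"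

definition begin_round :: "nat \<Rightarrow> local_state \<Rightarrow> local_state" where
  "begin_round m s = raise_from m 1 (s\<lparr>round_no := round_no s + 1\<rparr>)"

definition release_from :: "nat \<Rightarrow> nat \<Rightarrow> local_state \<Rightarrow> local_state" where
  "release_from m j s =
     (case find (myview s) [j..<Suc m] of
        Some k \<Rightarrow> s\<lparr>location := Release k\<rparr>
      | None \<Rightarrow> s\<lparr>location := Returned Not_Leader\<rparr>)"

definition end_round :: "nat \<Rightarrow> nat \<Rightarrow> nat \<Rightarrow> local_state \<Rightarrow> local_state" where
  "end_round n m d s =
     (let competitors = real n - real (round_no s) + 1
      in if real (counter s) < real m / competitors then release_from m 1 s
         else if round_no s = n - d + 1 then s\<lparr>location := Returned Leader\<rparr>
         else begin_round m s)"

definition leave_while :: "nat \<Rightarrow> nat \<Rightarrow> nat \<Rightarrow> nat \<Rightarrow> local_state \<Rightarrow> local_state" where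
  "leave_while n m d j s =
     (if j < m then s\<lparr>location := Test (j + 1)\<rparr> else end_round n m d s)"

definition election_init :: "nat \<Rightarrow> local_state" where
  "election_init m =
     begin_round m \<lparr>counter = 0, round_no = 0, myview = (\<lambda>_. False), location = Test 1\<rparr>"

definition election_action :: "local_state \<Rightarrow> nat action" where
  "election_action s =
     (case location s of
        Raise j \<Rightarrow> Invoke (Write j (round_no s))
      | Test j \<Rightarrow> Invoke (Read j)
      | Claim j \<Rightarrow> Invoke (Compare_And_Swap j 0 (round_no s))
      | Release j \<Rightarrow> Invoke (Write j 0)
      | Returned v \<Rightarrow> Return v)"

text \<open>The final case is never used: a response always matches the operation invoked.\<close>

definition election_receive ::
  "nat \<Rightarrow> nat \<Rightarrow> nat \<Rightarrow> local_state \<Rightarrow> nat response \<Rightarrow> local_state"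
where
  "election_receive n m d s r =
     (case (location s, r) of
        (Raise j, Ack) \<Rightarrow> raise_from m (j + 1) s
      | (Test j, Val v) \<Rightarrow>
          (if v < round_no s then s\<lparr>location := Claim j\<rparr> else leave_while n m d j s)
      | (Claim j, Outcome b) \<Rightarrow>
          s\<lparr>myview := (myview s)(j := b),
            counter := (if b then counter s + 1 else counter s),
            location := Test j\<rparr>
      | (Release j, Ack) \<Rightarrow> release_from m (j + 1) s
      | _ \<Rightarrow> s)"

definition election_algorithm :: "nat \<Rightarrow> nat \<Rightarrow> nat \<Rightarrow> (local_state, nat) algorithm" where
  "election_algorithm n m d =
     \<lparr>init_reg = 0,
      init_state = election_init m,
      next_action = election_action,
      receive = election_receive n m d\<rparr>"


section \<open>Admissible numbers of registers\<close>

definition M :: "nat \<Rightarrow> nat \<Rightarrow> nat set" where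
  "M n d = {k. k \<ge> 1 \<and> (\<forall>l. 1 < l \<and> l \<le> n \<longrightarrow> gcd l k \<le> d)}"

end

theory Submission
  imports Defs
begin

text \<open>
  Registers that a process owns are never taken from it before it releases them, so the sets of
  registers owned by the processes that have not lost are always disjoint. A process that
  has passed the check of round \<open>r - 1\<close> and has not lost owns at least \<open>m / l\<close> registers, where
  \<open>l = n - r + 2\<close>. Hence at most \<open>l\<close> such processes exist at any time, and if there are exactly
  \<open>l\<close> of them then \<open>l\<close> divides \<open>m\<close>, which \<open>m \<in> M n d\<close> excludes for \<open>d < l \<le> n\<close>. So at any
  time at most \<open>n - r + 1\<close> processes that have not lost are in round \<open>r\<close> or later; in
  particular at most \<open>d\<close> processes are elected. (More processes may enter round \<open>r\<close> over
  time, since a late process can take registers released by a loser.)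

  When for the first time a process loses in a round \<open>\<ge> r\<close>, being itself in round \<open>r\<close>, it has
  seen every register with a value \<open>\<ge> r\<close>, so all registers are owned by the at most
  \<open>n - r + 1\<close> competitors that have not lost, and one of them owns at least \<open>m / (n - r + 1)\<close>.
  It never falls back, so the losers never catch up with everybody, and some process is elected.

  For termination, a process that never returns ends up waiting for a register whose value is
  nonzero and smaller than its round. For a process in the least round among the waiting ones this is
  impossible, since the owner of that register is waiting in a round at least as high or is elected.
\<close>

section \<open>Local states\<close>

text \<open>A process stops being live when it fails a check, before its first release; a loser may
  therefore still own registers.\<close>

definition live :: "local_state \<Rightarrow> bool" where
  "live s = (case location s of Release j \<Rightarrow> False | Returned v \<Rightarrow> v = Leader | _ \<Rightarrow> True)"

text \<open>The array \<open>myview\<close> is not reset by a release, so it overestimates what a loser owns.\<close>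

definition owned :: "local_state \<Rightarrow> nat set" where
  "owned s = {k. myview s k \<and>
     (case location s of Release j \<Rightarrow> j \<le> k | Returned v \<Rightarrow> v = Leader | _ \<Rightarrow> True)}"

text \<open>The owned registers among these may still hold the number of the previous round.\<close>

definition pending :: "local_state \<Rightarrow> nat set" where
  "pending s = {k. case location s of Raise j \<Rightarrow> j \<le> k | _ \<Rightarrow> False}"

definition passed :: "local_state \<Rightarrow> nat set" where
  "passed s = (case location s of Test j \<Rightarrow> {1..<j} | Claim j \<Rightarrow> {1..<j} | _ \<Rightarrow> {})"

text \<open>The condition \<open>\<not> myview s j\<close> at \<open>Claim j\<close> makes a
  successful claim gain a new index, so that \<open>counter\<close> stays a cardinality, and makes
  the assignment after a failed claim change nothing. The bound for a leader is the check of the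
  last round, which has \<open>d\<close> competitors.\<close>

definition location_inv :: "nat \<Rightarrow> nat \<Rightarrow> nat \<Rightarrow> local_state \<Rightarrow> bool" where
  "location_inv n m d s = (case location s of
       Raise j \<Rightarrow> j \<in> {1..m} \<and> myview s j
     | Test j \<Rightarrow> j \<in> {1..m}
     | Claim j \<Rightarrow> j \<in> {1..m} \<and> \<not> myview s j
     | Release j \<Rightarrow> j \<in> {1..m} \<and> myview s j
     | Returned v \<Rightarrow> v = Leader \<longrightarrow> round_no s = n - d + 1 \<and> m \<le> counter s * d)"

text \<open>\<open>n + 2 - round_no s\<close> is the number of competitors in the round before the current one.\<close>

definition local_inv :: "nat \<Rightarrow> nat \<Rightarrow> nat \<Rightarrow> local_state \<Rightarrow> bool" where
  "local_inv n m d s \<longleftrightarrow>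
     {k. myview s k} \<subseteq> {1..m} \<and> card {k. myview s k} = counter s \<and>
     1 \<le> round_no s \<and> round_no s \<le> n - d + 1 \<and>
     (2 \<le> round_no s \<longrightarrow> m \<le> counter s * (n + 2 - round_no s)) \<and>
     location_inv n m d s"

section \<open>Loops over the owned registers\<close>

lemma find_upt_SomeD:
  assumes "find Q [j..<u] = Some k"
  shows "j \<le> k \<and> k < u \<and> Q k \<and> (\<forall>l. j \<le> l \<and> l < k \<longrightarrow> \<not> Q l)"
proof -
  obtain i where "i < length [j..<u]" "Q ([j..<u] ! i)" "k = [j..<u] ! i"
    "\<forall>l<i. \<not> Q ([j..<u] ! l)"
    using assms by (auto simp: find_Some_iff)
  then have i: "i < u - j" "k = j + i" "Q k" "\<forall>l<i. \<not> Q (j + l)" by auto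
  have "\<not> Q l" if "j \<le> l" "l < k" for l
    using i(4)[rule_format, of "l - j"] that i(2) by simp
  then show ?thesis using i by auto
qed

lemma find_upt_NoneD: "find Q [j..<u] = None \<Longrightarrow> j \<le> l \<Longrightarrow> l < u \<Longrightarrow> \<not> Q l"
  by (auto simp: find_None_iff)

lemma raise_from_cases:
  obtains (raise) k where "raise_from m j s = s\<lparr>location := Raise k\<rparr>" "j \<le> k" "k \<le> m"
      "myview s k" "\<And>l. j \<le> l \<Longrightarrow> l < k \<Longrightarrow> \<not> myview s l"
  | (test) "raise_from m j s = s\<lparr>location := Test 1\<rparr>"
      "\<And>l. j \<le> l \<Longrightarrow> l \<le> m \<Longrightarrow> \<not> myview s l"
proof (cases "find (myview s) [j..<Suc m]")
  case None
  show ?thesis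
  proof (rule test)
    show "raise_from m j s = s\<lparr>location := Test 1\<rparr>"
      unfolding raise_from_def None by simp
    show "\<not> myview s l" if "j \<le> l" "l \<le> m" for l
      using find_upt_NoneD[OF None] that by simp
  qed
next
  case (Some k)
  show ?thesis
  proof (rule raise)
    show "raise_from m j s = s\<lparr>location := Raise k\<rparr>"
      unfolding raise_from_def Some by simp
  qed (use find_upt_SomeD[OF Some] in auto)
qed

lemma release_from_cases:
  obtains (release) k where "release_from m j s = s\<lparr>location := Release k\<rparr>" "j \<le> k" "k \<le> m"
      "myview s k" "\<And>l. j \<le> l \<Longrightarrow> l < k \<Longrightarrow> \<not> myview s l"
  | (return) "release_from m j s = s\<lparr>location := Returned Not_Leader\<rparr>"
      "\<And>l. j \<le> l \<Longrightarrow> l \<le> m \<Longrightarrow> \<not> myview s l"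
proof (cases "find (myview s) [j..<Suc m]")
  case None
  show ?thesis
  proof (rule return)
    show "release_from m j s = s\<lparr>location := Returned Not_Leader\<rparr>"
      unfolding release_from_def None by simp
    show "\<not> myview s l" if "j \<le> l" "l \<le> m" for l
      using find_upt_NoneD[OF None] that by simp
  qed
next
  case (Some k)
  show ?thesis
  proof (rule release)
    show "release_from m j s = s\<lparr>location := Release k\<rparr>"
      unfolding release_from_def Some by simp
  qed (use find_upt_SomeD[OF Some] in auto)
qed

text \<open>The search skips to the next owned index or ends the loop, so \<open>pending s'\<close>
  alone need not be \<open>{k. j \<le> k}\<close>; the two agree on owned indices, which is all the
  invariants use.\<close>

lemma raise_from_effect:
  assumes "{k. myview s k} \<subseteq> {1..m}" "1 \<le> m" "1 \<le> j"
  defines "s' \<equiv> raise_from m j s"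
  shows "round_no s' = round_no s" "counter s' = counter s" "myview s' = myview s"
    "live s'" "owned s' = {k. myview s k}" "passed s' = {}"
    "owned s' \<inter> pending s' = {k. myview s k \<and> j \<le> k}"
    "location_inv n m d s'"
proof -
  have "round_no s' = round_no s \<and> counter s' = counter s \<and> myview s' = myview s \<and>
    live s' \<and> owned s' = {k. myview s k} \<and> passed s' = {} \<and>
    owned s' \<inter> pending s' = {k. myview s k \<and> j \<le> k} \<and> location_inv n m d s'"
  proof (cases rule: raise_from_cases[of m j s])
    case (raise k)
    have "k \<le> l" if "myview s l" "j \<le> l" for l
      using raise(5)[of l] that by (meson not_less)
    then show ?thesis
      using raise assms(1-3)
      by (auto simp: s'_def live_def owned_def pending_def passed_def location_inv_def)
  next
    case test
    have "False" if "myview s l" "j \<le> l" for l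
      using test(2)[of l] that assms(1) by auto
    then show ?thesis
      using test assms(1-3)
      by (auto simp: s'_def live_def owned_def pending_def passed_def location_inv_def)
  qed
  then show "round_no s' = round_no s" "counter s' = counter s" "myview s' = myview s"
    "live s'" "owned s' = {k. myview s k}" "passed s' = {}"
    "owned s' \<inter> pending s' = {k. myview s k \<and> j \<le> k}"
    "location_inv n m d s'" by auto
qed

lemma release_from_effect:
  assumes "{k. myview s k} \<subseteq> {1..m}" "1 \<le> j"
  defines "s' \<equiv> release_from m j s"
  shows "round_no s' = round_no s" "counter s' = counter s" "myview s' = myview s"
    "\<not> live s'" "owned s' = {k. myview s k \<and> j \<le> k}" "passed s' = {}" "pending s' = {}"
    "location_inv n m d s'"
proof -
  have "round_no s' = round_no s \<and> counter s' = counter s \<and> myview s' = myview s \<and>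
    \<not> live s' \<and> owned s' = {k. myview s k \<and> j \<le> k} \<and> passed s' = {} \<and> pending s' = {} \<and>
    location_inv n m d s'"
  proof (cases rule: release_from_cases[of m j s])
    case (release k)
    have "k \<le> l" if "myview s l" "j \<le> l" for l
      using release(5)[of l] that by (meson not_less)
    then show ?thesis
      using release assms(1-2)
      by (auto simp: s'_def live_def owned_def pending_def passed_def location_inv_def)
  next
    case return
    have "False" if "myview s l" "j \<le> l" for l
      using return(2)[of l] that assms(1) by auto
    then show ?thesis
      using return assms(1-2)
      by (auto simp: s'_def live_def owned_def pending_def passed_def location_inv_def)
  qed
  then show "round_no s' = round_no s" "counter s' = counter s" "myview s' = myview s"
    "\<not> live s'" "owned s' = {k. myview s k \<and> j \<le> k}" "passed s' = {}" "pending s' = {}"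
    "location_inv n m d s'" by auto
qed

section \<open>Effect of a step\<close>

locale election =
  fixes n m d :: nat and P :: "nat set" and f :: "nat \<Rightarrow> nat \<Rightarrow> nat"
  assumes m_pos: "1 \<le> m" and d_bounds: "d \<in> {1..n - 1}" and m_admissible: "m \<in> M n d"
    and P_nonempty: "P \<noteq> {}" and P_bounds: "P \<subseteq> {1..n}"
    and f_permutes: "\<And>i. i \<in> P \<Longrightarrow> f i permutes {1..m}"
begin

abbreviation "A \<equiv> election_algorithm n m d"

lemma finite_P: "finite P" using P_bounds finite_subset by blast

lemma f_eq_iff: "i \<in> P \<Longrightarrow> f i j = f i k \<longleftrightarrow> j = k"
  using f_permutes permutes_inj injD by metis

lemma f_range: "i \<in> P \<Longrightarrow> f i j \<in> {1..m} \<longleftrightarrow> j \<in> {1..m}"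
  using f_permutes permutes_in_image by metis

text \<open>The hypothesis and \<open>1 \<le> d\<close> give \<open>r \<le> n\<close>, so the
  denominator is positive and the truncated \<open>n + 1 - r\<close> is exact. Later counting stays
  in the naturals.\<close>

lemma below_share_iff:
  assumes "r \<le> n - d + 1"
  shows "real k < real m / (real n - real r + 1) \<longleftrightarrow> k * (n + 1 - r) < m"
proof -
  have r: "r \<le> n" using assms d_bounds by auto
  then have e: "real n - real r + 1 = real (n + 1 - r)" by simp
  have "real k < real m / real (n + 1 - r) \<longleftrightarrow> real k * real (n + 1 - r) < real m"
    using r by (subst pos_less_divide_eq) auto
  also have "\<dots> \<longleftrightarrow> k * (n + 1 - r) < m"
    by (metis of_nat_less_iff of_nat_mult)
  finally show ?thesis using e by simp
qed

section \<open>Invariants of configurations\<close>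

definition values_inv :: "(local_state, nat) config \<Rightarrow> bool" where
  "values_inv c \<longleftrightarrow> (\<forall>i\<in>P. \<forall>k\<in>owned (state c i).
     0 < memory c (f i k) \<and> memory c (f i k) \<le> round_no (state c i) \<and>
     (k \<notin> pending (state c i) \<longrightarrow> memory c (f i k) = round_no (state c i)))"

text \<open>With \<open>values_inv\<close>, the nonzero registers are exactly the disjoint union of
  the owned sets, once local names are translated to physical registers.\<close>

definition owners_inv :: "(local_state, nat) config \<Rightarrow> bool" where
  "owners_inv c \<longleftrightarrow>
     (\<forall>x\<in>{1..m}. memory c x \<noteq> 0 \<longrightarrow> (\<exists>i\<in>P. \<exists>k\<in>owned (state c i). f i k = x)) \<and>
     (\<forall>i\<in>P. \<forall>j\<in>P. \<forall>k\<in>owned (state c i). \<forall>l\<in>owned (state c j). f i k = f j l \<longrightarrow> i = j)"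

text \<open>
  Once a loser of the same or a later round releases registers, the values that have been tested
  may drop again.
\<close>

definition passed_inv :: "(local_state, nat) config \<Rightarrow> bool" where
  "passed_inv c \<longleftrightarrow> (\<forall>i\<in>P. \<forall>k\<in>passed (state c i).
     round_no (state c i) \<le> memory c (f i k) \<or>
     (\<exists>q\<in>P. \<not> live (state c q) \<and> round_no (state c i) \<le> round_no (state c q)))"

text \<open>The second case is a process that shares the round of a loser but is already sure to
  pass its check, since \<open>counter\<close> never decreases.\<close>

definition ahead :: "local_state \<Rightarrow> local_state \<Rightarrow> bool" where
  "ahead s t \<longleftrightarrow> round_no t < round_no s \<or>
     round_no t = round_no s \<and> m \<le> counter s * (n + 1 - round_no s)"

definition survivor_inv :: "(local_state, nat) config \<Rightarrow> bool" where
  "survivor_inv c \<longleftrightarrow> (\<exists>p\<in>P. live (state c p) \<and>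
     (\<forall>q\<in>P. \<not> live (state c q) \<longrightarrow> ahead (state c p) (state c q)))"

definition config_inv :: "(local_state, nat) config \<Rightarrow> bool" where
  "config_inv c \<longleftrightarrow> (\<forall>i\<in>P. local_inv n m d (state c i)) \<and>
     values_inv c \<and> owners_inv c \<and> passed_inv c \<and> survivor_inv c"

lemma config_inv_initial: "config_inv (initial_config A)"
proof -
  let ?s = "election_init m"
  have s: "?s = raise_from m 1 \<lparr>counter = 0, round_no = 1, myview = (\<lambda>_. False), location = Test 1\<rparr>"
    by (simp add: election_init_def begin_round_def)
  note e = raise_from_effect[of "\<lparr>counter = 0, round_no = 1, myview = (\<lambda>_. False), location = Test 1\<rparr>"
      m 1, folded s]
  have "local_inv n m d ?s" "owned ?s = {}" "passed ?s = {}" "live ?s"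
    using e m_pos by (auto simp: local_inv_def)
  then show ?thesis
    using P_nonempty
    by (auto simp: config_inv_def initial_config_def election_algorithm_def values_inv_def
        owners_inv_def passed_inv_def survivor_inv_def)
qed

lemma step_elim:
  assumes inv: "local_inv n m d (state c i)" and step: "step A f i c c'"
  defines "s \<equiv> state c i" and "s' \<equiv> state c' i"
  obtains
    (raise) j where "location s = Raise j" "memory c' = (memory c)(f i j := round_no s)"
      "s' = raise_from m (j + 1) s"
  | (test_fail) j where "location s = Test j" "memory c' = memory c" "memory c (f i j) < round_no s"
      "s' = s\<lparr>location := Claim j\<rparr>"
  | (test_next) j where "location s = Test j" "memory c' = memory c" "round_no s \<le> memory c (f i j)"
      "j < m" "s' = s\<lparr>location := Test (j + 1)\<rparr>"
  | (lose) "location s = Test m" "memory c' = memory c" "round_no s \<le> memory c (f i m)"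
      "counter s * (n + 1 - round_no s) < m" "s' = release_from m 1 s"
  | (win) "location s = Test m" "memory c' = memory c" "round_no s \<le> memory c (f i m)"
      "m \<le> counter s * (n + 1 - round_no s)" "round_no s = n - d + 1"
      "s' = s\<lparr>location := Returned Leader\<rparr>"
  | (advance) "location s = Test m" "memory c' = memory c" "round_no s \<le> memory c (f i m)"
      "m \<le> counter s * (n + 1 - round_no s)" "round_no s < n - d + 1"
      "s' = raise_from m 1 (s\<lparr>round_no := round_no s + 1\<rparr>)"
  | (claim) j where "location s = Claim j" "memory c (f i j) = 0"
      "memory c' = (memory c)(f i j := round_no s)"
      "s' = s\<lparr>myview := (myview s)(j := True), counter := counter s + 1, location := Test j\<rparr>"
  | (claim_fail) j where "location s = Claim j" "memory c' = memory c" "memory c (f i j) \<noteq> 0"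
      "s' = s\<lparr>myview := (myview s)(j := False), location := Test j\<rparr>"
  | (release) j where "location s = Release j" "memory c' = (memory c)(f i j := 0)"
      "s' = release_from m (j + 1) s"
proof -
  obtain oper R' r where act: "election_action s = Invoke oper"
    and perf: "perform (f i) oper (memory c) = (R', r)"
    and M': "memory c' = R'" and s': "s' = election_receive n m d s r"
    using step unfolding step_def s_def s'_def election_algorithm_def by auto
  have linv: "local_inv n m d s" using inv s_def by simp
  show thesis
  proof (cases "location s")
    case (Raise j)
    then show thesis
      using raise[of j] act perf M' s' by (auto simp: election_action_def election_receive_def)
  next
    case (Claim j)
    then show thesis
      using claim[of j] claim_fail[of j] act perf M' s'
      by (auto simp: election_action_def election_receive_def split: if_splits)
  next
    case (Release j)
    then show thesis
      using release[of j] act perf M' s' by (auto simp: election_action_def election_receive_def)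
  next
    case (Returned v)
    then show thesis using act by (simp add: election_action_def)
  next
    case (Test j)
    then have r: "R' = memory c" "r = Val (memory c (f i j))"
      using act perf by (auto simp: election_action_def)
    have j: "j \<le> m" using linv Test by (auto simp: local_inv_def location_inv_def)
    show thesis
    proof (cases "memory c (f i j) < round_no s")
      case True
      then show thesis
        using test_fail[of j] Test r M' s' by (auto simp: election_receive_def)
    next
      case False
      then have s'': "s' = leave_while n m d j s"
        using Test r s' by (auto simp: election_receive_def)
      have rn: "round_no s \<le> n - d + 1" using linv by (simp add: local_inv_def)
      show thesis
      proof (cases "j < m")
        case True
        then show thesis
          using test_next[of j] Test r M' s'' False by (auto simp: leave_while_def)
      next
        case jm: False
        then have jm: "j = m" using j by simp
        have s'': "s' = (if counter s * (n + 1 - round_no s) < m then release_from m 1 s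
            else if round_no s = n - d + 1 then s\<lparr>location := Returned Leader\<rparr>
            else raise_from m 1 (s\<lparr>round_no := round_no s + 1\<rparr>))"
          using s'' jm below_share_iff[OF rn, of "counter s"]
          by (simp add: leave_while_def end_round_def begin_round_def Let_def)
        show thesis
          using lose win advance Test r M' s'' False jm rn
          by (auto split: if_splits simp: not_less)
      qed
    qed
  qed
qed

text \<open>An owned index outside \<open>pending\<close> holds the round number exactly, so its
  test cannot fail. This yields the condition attached to \<open>Claim j\<close> in
  \<open>location_inv\<close>.\<close>

lemma test_fail_not_owned:
  assumes "i \<in> P" "config_inv c" "location (state c i) = Test j"
    "memory c (f i j) < round_no (state c i)"
  shows "\<not> myview (state c i) j"
proof
  assume "myview (state c i) j"
  then have "j \<in> owned (state c i)" "j \<notin> pending (state c i)"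
    using assms(3) by (auto simp: owned_def pending_def)
  then show False
    using assms by (auto simp: config_inv_def values_inv_def)
qed

lemma local_inv_same_view:
  "local_inv n m d s \<Longrightarrow> round_no s' = round_no s \<Longrightarrow> counter s' = counter s \<Longrightarrow>
    myview s' = myview s \<Longrightarrow> location_inv n m d s' \<Longrightarrow> local_inv n m d s'"
  by (simp add: local_inv_def)

lemma local_inv_step:
  assumes i: "i \<in> P" and inv: "config_inv c" and step: "step A f i c c'"
  shows "local_inv n m d (state c' i)"
proof -
  let ?s = "state c i"
  have linv: "local_inv n m d ?s" using i inv by (simp add: config_inv_def)
  have view: "{k. myview ?s k} \<subseteq> {1..m}" using linv by (simp add: local_inv_def)
  then have fin: "finite {k. myview ?s k}" by (rule finite_subset) simp
  note l = linv[unfolded local_inv_def]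
  from linv step show ?thesis
  proof (cases rule: step_elim)
    case (raise j)
    then show ?thesis
      using raise_from_effect[OF view m_pos, of "j + 1"]
      by (intro local_inv_same_view[OF linv]) auto
  next
    case (test_fail j)
    then show ?thesis
      using l test_fail_not_owned[OF i inv test_fail(1,3)]
      by (simp add: local_inv_def location_inv_def)
  next
    case (test_next j)
    then show ?thesis
      using l by (simp add: local_inv_def location_inv_def)
  next
    case lose
    then show ?thesis
      using release_from_effect[OF view, of 1]
      by (intro local_inv_same_view[OF linv]) auto
  next
    case win
    then have "n + 1 - round_no ?s = d" using d_bounds by auto
    then show ?thesis
      using l win by (auto simp: local_inv_def location_inv_def)
  next
    case advance
    \<comment> \<open>The check just passed in round \<open>r\<close> has the factor
      \<open>n + 1 - r\<close>, which is \<open>n + 2 - r'\<close> for the new round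
      \<open>r' = r + 1\<close>, as \<open>local_inv\<close> demands.\<close>
    have "m \<le> counter ?s * (n + 2 - (round_no ?s + 1))"
      using advance(4) by simp
    then show ?thesis
      using raise_from_effect[of "?s\<lparr>round_no := round_no ?s + 1\<rparr>" m 1] view m_pos l advance
      by (simp add: local_inv_def)
  next
    case (claim j)
    have j: "j \<in> {1..m}" "\<not> myview ?s j"
      using l claim(1) by (auto simp: location_inv_def)
    have e: "{k. ((myview ?s)(j := True)) k} = insert j {k. myview ?s k}" by auto
    have "m \<le> (counter ?s + 1) * (n + 2 - round_no ?s)" if "2 \<le> round_no ?s"
      using l that by (auto simp: add_mult_distrib)
    then show ?thesis
      using claim(4) l j fin e by (simp add: local_inv_def location_inv_def)
  next
    case (claim_fail j)
    have j: "j \<in> {1..m}" "\<not> myview ?s j"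
      using l claim_fail(1) by (auto simp: location_inv_def)
    then have e: "(myview ?s)(j := False) = myview ?s" by (auto simp: fun_eq_iff)
    show ?thesis
      using claim_fail(4) l j e by (simp add: local_inv_def location_inv_def)
  next
    case (release j)
    then show ?thesis
      using release_from_effect[OF view, of "j + 1"]
      by (intro local_inv_same_view[OF linv]) auto
  qed
qed

text \<open>Forgets control locations and keeps what the global invariants refer to.
  \<open>quiet\<close> gathers failed tests, successful tests that do not end a round, failed
  claims, and winning: none of them touches memory or ownership.\<close>

lemma step_cases:
  assumes i: "i \<in> P" and inv: "config_inv c" and step: "step A f i c c'"
  defines "s \<equiv> state c i" and "s' \<equiv> state c' i"
  obtains
    (raise) j where "j \<in> owned s" "memory c' = (memory c)(f i j := round_no s)"
      "round_no s' = round_no s" "counter s' = counter s" "live s" "live s'"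
      "owned s' = owned s" "owned s \<inter> pending s \<subseteq> insert j (pending s')" "passed s' = {}"
  | (quiet) "memory c' = memory c"
      "round_no s' = round_no s" "counter s' = counter s" "live s" "live s'"
      "owned s' = owned s" "pending s = {}" "passed s' \<subseteq> passed s \<union> {k. round_no s \<le> memory c (f i k)}"
  | (advance) "memory c' = memory c"
      "round_no s' = round_no s + 1" "counter s' = counter s" "live s" "live s'"
      "owned s' = owned s" "pending s = {}" "owned s \<subseteq> pending s'" "passed s' = {}"
  | (claim) j where "j \<in> {1..m}" "memory c (f i j) = 0" "memory c' = (memory c)(f i j := round_no s)"
      "round_no s' = round_no s" "counter s' = counter s + 1" "live s" "live s'"
      "owned s' = insert j (owned s)" "pending s = {}" "passed s' = passed s"
  | (lose) "memory c' = memory c"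
      "round_no s' = round_no s" "counter s' = counter s" "live s" "\<not> live s'"
      "owned s' = owned s" "pending s = {}" "passed s' = {}"
      "counter s * (n + 1 - round_no s) < m"
      "{1..m} \<subseteq> passed s \<union> {k. round_no s \<le> memory c (f i k)}"
  | (release) j where "j \<in> owned s" "memory c' = (memory c)(f i j := 0)"
      "round_no s' = round_no s" "counter s' = counter s" "\<not> live s" "\<not> live s'"
      "owned s' = owned s - {j}" "pending s = {}" "passed s' = {}"
proof -
  have linv: "local_inv n m d s" using i inv by (simp add: config_inv_def s_def)
  have view: "{k. myview s k} \<subseteq> {1..m}" using linv by (simp add: local_inv_def)
  note l = linv[unfolded local_inv_def]
  from linv[unfolded s_def] step show thesis
  proof (cases rule: step_elim)
    case step_raise: (raise j)
    note h = step_raise[folded s_def s'_def]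
    note e = raise_from_effect[OF view m_pos, of "j + 1", folded h(3)]
    have "myview s j" using l h(1) by (simp add: location_inv_def)
    then have "j \<in> owned s" "live s" "owned s = {k. myview s k}" "pending s = {k. j \<le> k}"
      using h(1) by (auto simp: owned_def live_def pending_def)
    then show thesis
      using h(2) e by (intro raise[of j]) auto
  next
    case (test_fail j)
    note h = test_fail[folded s_def s'_def]
    show thesis
      using h by (intro quiet) (auto simp: owned_def pending_def live_def passed_def)
  next
    case (test_next j)
    note h = test_next[folded s_def s'_def]
    show thesis
      using h by (intro quiet) (auto simp: owned_def pending_def live_def passed_def less_Suc_eq)
  next
    case step_lose: lose
    note h = step_lose[folded s_def s'_def]
    note e = release_from_effect[OF view, of 1, folded h(5)]
    have "owned s = {k. myview s k}" "live s" "pending s = {}" "passed s = {1..<m}"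
      using h(1) by (auto simp: owned_def live_def pending_def passed_def)
    moreover have "{1..m} = insert m {1..<m}"
      using m_pos by auto
    moreover have "{k. myview s k \<and> 1 \<le> k} = {k. myview s k}"
      using view by auto
    ultimately show thesis
      using h(2-4) e by (intro lose) auto
  next
    case win
    note h = win[folded s_def s'_def]
    show thesis
      using h by (intro quiet) (auto simp: owned_def pending_def live_def passed_def)
  next
    case step_advance: advance
    note h = step_advance[folded s_def s'_def]
    note e = raise_from_effect[of "s\<lparr>round_no := round_no s + 1\<rparr>" m 1, folded h(6)]
    have "owned s = {k. myview s k}" "live s" "pending s = {}"
      using h(1) by (auto simp: owned_def live_def pending_def)
    moreover have "{k. myview s k \<and> 1 \<le> k} = {k. myview s k}"
      using view by auto
    ultimately show thesis
      using h(2) e view m_pos by (intro advance) auto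
  next
    case step_claim: (claim j)
    note h = step_claim[folded s_def s'_def]
    show thesis
      using h l by (intro claim[of j]) (auto simp: owned_def pending_def live_def passed_def location_inv_def)
  next
    case (claim_fail j)
    note h = claim_fail[folded s_def s'_def]
    have "(myview s)(j := False) = myview s" 
      using l h(1) by (auto simp: location_inv_def fun_eq_iff)
    then show thesis
      using h by (intro quiet) (auto simp: owned_def pending_def live_def passed_def)
  next
    case step_release: (release j)
    note h = step_release[folded s_def s'_def]
    note e = release_from_effect[OF view, of "j + 1", folded h(3)]
    have "myview s j" using l h(1) by (simp add: location_inv_def)
    then have "j \<in> owned s" "\<not> live s" "owned s = {k. myview s k \<and> j \<le> k}" "pending s = {}"
      using h(1) by (auto simp: owned_def live_def pending_def)
    then show thesis
      using h(2) e by (intro release[of j]) auto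
  qed
qed

lemma step_other: "step A f i c c' \<Longrightarrow> q \<noteq> i \<Longrightarrow> state c' q = state c q"
  by (auto simp: step_def)

section \<open>Counting owned registers\<close>

lemma owned_live: "live s \<Longrightarrow> owned s = {k. myview s k}"
  by (auto simp: live_def owned_def split: location.splits)

lemma owned_range: "config_inv c \<Longrightarrow> i \<in> P \<Longrightarrow> owned (state c i) \<subseteq> {1..m}"
  by (auto simp: config_inv_def local_inv_def owned_def)

lemma owners_unique:
  "config_inv c \<Longrightarrow> i \<in> P \<Longrightarrow> q \<in> P \<Longrightarrow> k \<in> owned (state c i) \<Longrightarrow> l \<in> owned (state c q) \<Longrightarrow>
    f i k = f q l \<Longrightarrow> i = q"
  unfolding config_inv_def owners_inv_def by metis

text \<open>Positivity shields an owned register from every compare-and-swap, whose expected value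
  is \<open>0\<close>; the upper bound turns a large value into a lower bound on the owner's
  round.\<close>

lemma owned_value:
  assumes "config_inv c" "i \<in> P" "k \<in> owned (state c i)"
  shows "0 < memory c (f i k)" "memory c (f i k) \<le> round_no (state c i)"
    "k \<notin> pending (state c i) \<Longrightarrow> memory c (f i k) = round_no (state c i)"
  using assms by (auto simp: config_inv_def values_inv_def)

text \<open>Ownership is disjoint across processes and each \<open>f p\<close> is injective, so
  cardinalities add up. Liveness matters: a loser keeps its \<open>counter\<close> while it gives
  registers back.\<close>

lemma sum_counters:
  assumes "config_inv c" "B \<subseteq> {p \<in> P. live (state c p)}"
  shows "(\<Sum>p\<in>B. counter (state c p)) = card (\<Union>p\<in>B. f p ` owned (state c p))"
proof -
  have fin: "finite B" using assms(2) finite_P finite_subset by fastforce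
  have "card (f p ` owned (state c p)) = counter (state c p)" if "p \<in> B" for p
  proof -
    have p: "p \<in> P" "live (state c p)" using that assms(2) by auto
    then have "card (f p ` owned (state c p)) = card (owned (state c p))"
      by (intro card_image) (auto simp: inj_on_def f_eq_iff)
    then show ?thesis
      using p assms(1) by (simp add: owned_live config_inv_def local_inv_def)
  qed
  moreover have "card (\<Union>p\<in>B. f p ` owned (state c p)) = (\<Sum>p\<in>B. card (f p ` owned (state c p)))"
  proof (rule card_UN_disjoint[OF fin])
    show "\<forall>p\<in>B. finite (f p ` owned (state c p))"
      using owned_range[OF assms(1)] assms(2) by (blast intro: finite_subset finite_imageI)
    show "\<forall>p\<in>B. \<forall>q\<in>B. p \<noteq> q \<longrightarrow> f p ` owned (state c p) \<inter> f q ` owned (state c q) = {}"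
      using owners_unique[OF assms(1)] assms(2) by fast
  qed
  ultimately show ?thesis by simp
qed

lemma sum_counters_le:
  assumes "config_inv c" "B \<subseteq> {p \<in> P. live (state c p)}"
  shows "(\<Sum>p\<in>B. counter (state c p)) \<le> m"
proof -
  have "(\<Union>p\<in>B. f p ` owned (state c p)) \<subseteq> {1..m}"
    using owned_range[OF assms(1)] assms(2) f_range by blast
  then show ?thesis
    using sum_counters[OF assms] card_mono[of "{1..m}"] by fastforce
qed

text \<open>Double counting: summing the hypothesis over \<open>B\<close> gives
  \<open>card B * m \<le> m * l\<close>, and \<open>m\<close> cancels.\<close>

lemma card_le_of_shares:
  assumes "config_inv c" "B \<subseteq> {p \<in> P. live (state c p)}"
    and "\<And>p. p \<in> B \<Longrightarrow> m \<le> counter (state c p) * l"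
  shows "card B \<le> l"
proof -
  have "card B * m = (\<Sum>p\<in>B. m)" by simp
  also have "\<dots> \<le> (\<Sum>p\<in>B. counter (state c p) * l)"
    by (rule sum_mono) (rule assms(3))
  also have "\<dots> \<le> m * l"
    using sum_counters_le[OF assms(1,2)] by (simp flip: sum_distrib_right)
  finally show ?thesis using m_pos by (simp add: mult.commute)
qed

text \<open>With exactly \<open>l\<close> members the double count is tight, so no member can exceed
  its share and its \<open>counter\<close> times \<open>l\<close> equals \<open>m\<close>.\<close>

lemma card_eq_imp_dvd:
  assumes "config_inv c" "B \<subseteq> {p \<in> P. live (state c p)}"
    and shares: "\<And>p. p \<in> B \<Longrightarrow> m \<le> counter (state c p) * l"
    and l: "card B = l" "0 < l"
  shows "l dvd m"
proof -
  have fin: "finite B" using l card_ge_0_finite by metis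
  obtain p where p: "p \<in> B" using l by fastforce
  have "counter (state c p) * l \<le> m"
  proof (rule ccontr)
    assume "\<not> ?thesis"
    then have "(\<Sum>p\<in>B. m) < (\<Sum>p\<in>B. counter (state c p) * l)"
      using p shares by (intro sum_strict_mono_ex1[OF fin]) (auto intro!: bexI[of _ p])
    also have "\<dots> \<le> m * l"
      using sum_counters_le[OF assms(1,2)] by (simp flip: sum_distrib_right)
    finally show False using l by simp
  qed
  then show ?thesis
    using shares[OF p] by (metis dvd_triv_right le_antisym)
qed

lemma card_contenders:
  assumes inv: "config_inv c" and r: "1 \<le> r" "r \<le> n - d + 1"
  shows "card {p \<in> P. live (state c p) \<and> r \<le> round_no (state c p)} \<le> n + 1 - r" (is "card ?B \<le> _")
proof (cases "r = 1")
  \<comment> \<open>No check precedes round 1; the bound is the total number of processes.\<close>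
  case True
  have "card ?B \<le> card {1..n}"
    using P_bounds by (intro card_mono) auto
  then show ?thesis using True by simp
next
  case False
  \<comment> \<open>The number of competitors in round \<open>r - 1\<close>, whose check every
    member of \<open>?B\<close> has passed.\<close>
  define l where "l = n + 2 - r"
  have l: "d < l" "1 < l" "l \<le> n"
    using r False d_bounds by (auto simp: l_def)
  have B: "?B \<subseteq> {p \<in> P. live (state c p)}" by auto
  have shares: "m \<le> counter (state c p) * l" if "p \<in> ?B" for p
  proof -
    have "m \<le> counter (state c p) * (n + 2 - round_no (state c p))"
      using that inv r False by (auto simp: config_inv_def local_inv_def)
    also have "\<dots> \<le> counter (state c p) * l"
      using that by (auto simp: l_def)
    finally show ?thesis .
  qed
  have "card ?B \<noteq> l"
  proof
    assume "card ?B = l"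
    then have "l dvd m" using card_eq_imp_dvd[OF inv B shares] l by simp
    \<comment> \<open>Here \<open>l dvd m\<close> gives \<open>gcd l m = l\<close>, which exceeds
      \<open>d\<close>, contrary to \<open>m \<in> M n d\<close>.\<close>
    then show False
      using l m_admissible by (auto simp: M_def gcd_nat.absorb1)
  qed
  then show ?thesis
    using card_le_of_shares[OF inv B shares] by (simp add: l_def)
qed

text \<open>A register value at least \<open>r\<close> forces its owner into round \<open>r\<close>
  or later, and \<open>no_loser\<close> makes that owner live. Hence the contenders own all
  \<open>m\<close> registers, and since there are at most \<open>n + 1 - r\<close> of them, they
  cannot all be below the average.\<close>

lemma exists_share:
  assumes inv: "config_inv c" and r: "1 \<le> r" "r \<le> n - d + 1"
    and full: "\<And>x. x \<in> {1..m} \<Longrightarrow> r \<le> memory c x"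
    and no_loser: "\<And>q. q \<in> P \<Longrightarrow> \<not> live (state c q) \<Longrightarrow> round_no (state c q) < r"
  shows "\<exists>p\<in>P. live (state c p) \<and> r \<le> round_no (state c p) \<and>
    m \<le> counter (state c p) * (n + 1 - r)"
proof (rule ccontr)
  assume contr: "\<not> ?thesis"
  let ?B = "{p \<in> P. live (state c p) \<and> r \<le> round_no (state c p)}"
  have B: "?B \<subseteq> {p \<in> P. live (state c p)}" by auto
  have "{1..m} \<subseteq> (\<Union>p\<in>?B. f p ` owned (state c p))"
  proof
    fix x assume x: "x \<in> {1..m}"
    then have "memory c x \<noteq> 0" using full r by fastforce
    then obtain p k where p: "p \<in> P" "k \<in> owned (state c p)" "f p k = x"
      using x inv unfolding config_inv_def owners_inv_def by metis
    have "r \<le> round_no (state c p)"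
      using owned_value(2)[OF inv p(1,2)] full[OF x] p(3) by simp
    then have "p \<in> ?B" using no_loser[OF p(1)] p(1) by fastforce
    then show "x \<in> (\<Union>p\<in>?B. f p ` owned (state c p))" using p by blast
  qed
  moreover have "finite (\<Union>p\<in>?B. f p ` owned (state c p))"
    using owned_range[OF inv] finite_P by (auto intro: finite_subset)
  ultimately have "card {1..m} \<le> card (\<Union>p\<in>?B. f p ` owned (state c p))"
    by (intro card_mono)
  then have full_sum: "m \<le> (\<Sum>p\<in>?B. counter (state c p))"
    using sum_counters[OF inv B] by simp
  then have "?B \<noteq> {}" using m_pos by fastforce
  then have "(\<Sum>p\<in>?B. counter (state c p) * (n + 1 - r)) < (\<Sum>p\<in>?B. m)"
    using contr finite_P by (intro sum_strict_mono) (auto simp: not_le)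
  also have "\<dots> \<le> m * (n + 1 - r)"
    using card_contenders[OF inv r] by simp
  finally have "(\<Sum>p\<in>?B. counter (state c p)) < m"
    by (simp flip: sum_distrib_right)
  then show False using full_sum by simp
qed

section \<open>Preservation of the invariant\<close>

lemma values_inv_step:
  assumes i: "i \<in> P" and inv: "config_inv c" and step: "step A f i c c'"
  shows "values_inv c'"
  unfolding values_inv_def
proof (intro ballI)
  fix q k assume q: "q \<in> P" and k: "k \<in> owned (state c' q)"
  note same = step_other[OF step]
  note val = owned_value[OF inv]
  have pos: "1 \<le> round_no (state c i)"
    using i inv by (simp add: config_inv_def local_inv_def)
  show "0 < memory c' (f q k) \<and> memory c' (f q k) \<le> round_no (state c' q) \<and>
     (k \<notin> pending (state c' q) \<longrightarrow> memory c' (f q k) = round_no (state c' q))"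
  proof (cases "q = i")
    case True
    note k = k[unfolded True]
    from i inv step have "0 < memory c' (f i k) \<and> memory c' (f i k) \<le> round_no (state c' i) \<and>
      (k \<notin> pending (state c' i) \<longrightarrow> memory c' (f i k) = round_no (state c' i))"
    proof (cases rule: step_cases)
      case (raise j)
      then show ?thesis using k val[OF i, of k] pos f_eq_iff[OF i, of k j] by auto
    next
      case quiet
      then show ?thesis using k val[OF i, of k] by auto
    next
      case advance
      then show ?thesis using k val[OF i, of k] by auto
    next
      case (claim j)
      then show ?thesis using k val[OF i, of k] pos f_eq_iff[OF i, of k j] by auto
    next
      case lose
      then show ?thesis using k val[OF i, of k] by auto
    next
      case (release j)
      then show ?thesis using k val[OF i, of k] f_eq_iff[OF i, of k j] by auto
    qed
    then show ?thesis using True by simp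
  next
    case False
    then have st: "state c' q = state c q" by (rule same)
    \<comment> \<open>Raising and releasing write only to registers owned by the moving process,
      hence to none owned by \<open>q\<close>. A claim writes to a register holding
      \<open>0\<close>, which nobody owns.\<close>
    have ne: "f q k \<noteq> f i j" if "j \<in> owned (state c i)" for j
      using owners_unique[OF inv q i, of k j] k st that False by auto
    have "memory c' (f q k) = memory c (f q k)"
      using i inv step
    proof (cases rule: step_cases)
      case (raise j)
      then show ?thesis using ne by simp
    next
      case (claim j)
      then have "f q k \<noteq> f i j" using k st val(1)[OF q, of k] by auto
      then show ?thesis using claim by simp
    next
      case (release j)
      then show ?thesis using ne by simp
    qed auto
    then show ?thesis using k st val[OF q] by auto
  qed
qed

lemma owners_inv_step:
  assumes i: "i \<in> P" and inv: "config_inv c" and step: "step A f i c c'"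
  shows "owners_inv c'"
  unfolding owners_inv_def
proof (intro conjI ballI impI)
  note same = step_other[OF step]
  have old: "\<exists>p\<in>P. \<exists>k\<in>owned (state c p). f p k = x" if "x \<in> {1..m}" "memory c x \<noteq> 0" for x
    using inv that by (simp add: config_inv_def owners_inv_def)
  fix x assume x: "x \<in> {1..m}" "memory c' x \<noteq> 0"
  have lift: "\<exists>p\<in>P. \<exists>k\<in>owned (state c' p). f p k = x"
    if "p \<in> P" "k \<in> owned (state c p)" "f p k = x"
      "p = i \<Longrightarrow> k \<in> owned (state c' i)" for p k
    using that same[of p] by metis
  from i inv step show "\<exists>p\<in>P. \<exists>k\<in>owned (state c' p). f p k = x"
  proof (cases rule: step_cases)
    case (raise j)
    then have "memory c x \<noteq> 0" using x owned_value(1)[OF inv i] by (auto split: if_splits)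
    then show ?thesis using old x lift raise by metis
  next
    case quiet
    then show ?thesis using old x lift by metis
  next
    case advance
    then show ?thesis using old x lift by metis
  next
    case (claim j)
    show ?thesis
    proof (cases "x = f i j")
      case True
      then show ?thesis using claim i by auto
    next
      case False
      then have "memory c x \<noteq> 0" using x claim by auto
      then show ?thesis using old x lift claim by (metis insertCI)
    qed
  next
    case lose
    then show ?thesis using old x lift by metis
  next
    case (release j)
    then have "memory c x \<noteq> 0" "x \<noteq> f i j" using x by (auto split: if_splits)
    then show ?thesis using old x lift release by (metis DiffI singletonD)
  qed
next
  note same = step_other[OF step]
  fix p q k l
  assume a: "p \<in> P" "q \<in> P" "k \<in> owned (state c' p)" "l \<in> owned (state c' q)" "f p k = f q l"
  note uniq = owners_unique[OF inv]
  from i inv step show "p = q"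
  proof (cases rule: step_cases)
    case (claim j)
    have unowned: "f r h \<noteq> f i j" if "r \<in> P" "h \<in> owned (state c r)" for r h
      using claim(2) owned_value(1)[OF inv that] by auto
    show ?thesis
      using a claim same uniq[of p q k l] unowned[of p k] unowned[of q l] by (cases "p = i"; cases "q = i") auto
  qed (use a same uniq[of p q k l] in \<open>cases "p = i"; cases "q = i"; auto\<close>)+
qed

text \<open>Raising writes the owner's round, which is no smaller than the old value, so a tested
  value drops only through a release. The released value is at most the round of the releasing
  loser, which then witnesses the second disjunct.\<close>

lemma passed_inv_step:
  assumes i: "i \<in> P" and inv: "config_inv c" and step: "step A f i c c'"
  shows "passed_inv c'"
  unfolding passed_inv_def
proof (intro ballI)
  note same = step_other[OF step]
  fix p k assume p: "p \<in> P" and k: "k \<in> passed (state c' p)"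
  let ?loser = "\<lambda>c. \<exists>q\<in>P. \<not> live (state c q) \<and> round_no (state c' p) \<le> round_no (state c q)"
  have old: "round_no (state c r) \<le> memory c (f r h) \<or>
     (\<exists>q\<in>P. \<not> live (state c q) \<and> round_no (state c r) \<le> round_no (state c q))"
    if "r \<in> P" "h \<in> passed (state c r)" for r h
    using inv that unfolding config_inv_def passed_inv_def by blast
  have lost: "?loser c'" if loser: "?loser c"
  proof -
    obtain q where q: "q \<in> P" "\<not> live (state c q)" "round_no (state c' p) \<le> round_no (state c q)"
      using loser by auto
    from i inv step have "q = i \<Longrightarrow> \<not> live (state c' i) \<and> round_no (state c' i) = round_no (state c i)"
      by (cases rule: step_cases) (use q in auto)
    then show ?thesis using q same by metis
  qed
  have base: "round_no (state c' p) \<le> memory c (f p k) \<or> ?loser c"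
  proof (cases "p = i")
    case True
    from i inv step show ?thesis
      by (cases rule: step_cases) (use k True old[OF i, of k] in auto)
  next
    case False
    then show ?thesis using old[OF p, of k] k same by auto
  qed
  have "round_no (state c' p) \<le> memory c' (f p k) \<or> ?loser c'"
    if le: "round_no (state c' p) \<le> memory c (f p k)"
    using i inv step
  proof (cases rule: step_cases)
    case (raise j)
    then show ?thesis using le owned_value(2)[OF inv i, of j] by auto
  next
    case (release j)
    show ?thesis
    proof (cases "f p k = f i j")
      case True
      then have "round_no (state c' p) \<le> round_no (state c i)"
        using le owned_value(2)[OF inv i, of j] release by simp
      then show ?thesis using release i by auto
    next
      case False
      then show ?thesis using le release by auto
    qed
  qed (use le in auto)
  then show "round_no (state c' p) \<le> memory c' (f p k) \<or> ?loser c'"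
    using base lost by blast
qed

lemma survivor_inv_step:
  assumes i: "i \<in> P" and inv: "config_inv c" and step: "step A f i c c'"
  shows "survivor_inv c'"
proof -
  note same = step_other[OF step]
  let ?s = "state c i" and ?s' = "state c' i"
  obtain p where p: "p \<in> P" "live (state c p)"
    "\<And>q. q \<in> P \<Longrightarrow> \<not> live (state c q) \<Longrightarrow> ahead (state c p) (state c q)"
    using inv unfolding config_inv_def survivor_inv_def by blast
  \<comment> \<open>Covers every step except a loss: a claim only raises \<open>counter\<close>, and
    an advance turns a tie of rounds into a strict lead.\<close>
  have keep: "survivor_inv c'"
    if "live ?s \<Longrightarrow> live ?s'" "\<And>t. ahead ?s t \<Longrightarrow> ahead ?s' t" "\<not> live ?s \<Longrightarrow> round_no ?s' = round_no ?s"
      "live ?s' \<Longrightarrow> live ?s"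
    unfolding survivor_inv_def
  proof (intro bexI conjI ballI impI)
    show "live (state c' p)" using p(2) that(1) same by (cases "p = i") auto
    fix q assume q: "q \<in> P" "\<not> live (state c' q)"
    have "ahead (state c p) (state c' q)"
    proof (cases "q = i")
      case True
        then have "\<not> live ?s" using q that(1) by blast
      then show ?thesis using True that(3) p(3)[OF i] by (simp add: ahead_def)
    next
      case False
      then show ?thesis using q p(3)[of q] same by auto
    qed
    then show "ahead (state c' p) (state c' q)"
      using that(2) same by (cases "p = i") auto
  qed (rule p(1))
  from i inv step show ?thesis
  proof (cases rule: step_cases)
    case (claim j)
    then show ?thesis by (intro keep) (auto simp: ahead_def add_mult_distrib)
  next
    case lose
    let ?r = "round_no ?s"
    have r: "1 \<le> ?r" "?r \<le> n - d + 1" using inv i by (auto simp: config_inv_def local_inv_def)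
    show ?thesis
    proof (cases "\<exists>q\<in>P. \<not> live (state c q) \<and> ?r \<le> round_no (state c q)")
      \<comment> \<open>The survivor is ahead of an earlier loser whose round is at least that of
        \<open>i\<close>, hence ahead of \<open>i\<close>. It is not \<open>i\<close> itself, which
        misses the share that \<open>ahead\<close> asks for within one round.\<close>
      case True
      then obtain q where q: "q \<in> P" "\<not> live (state c q)" "?r \<le> round_no (state c q)" by auto
      have ai: "ahead (state c p) ?s" using p(3)[OF q(1,2)] q(3) by (auto simp: ahead_def)
      have "p \<noteq> i" using ai lose by (auto simp: ahead_def)
      then have "state c' p = state c p" by (rule same)
      moreover have "ahead (state c p) (state c' q)" if "q \<in> P" "\<not> live (state c' q)" for q
      proof (cases "q = i")
        case True
        then show ?thesis using ai lose(2) by (simp add: ahead_def)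
      next
        case False
        then show ?thesis using that p(3)[of q] same by simp
      qed
      ultimately show ?thesis
        unfolding survivor_inv_def using p(1,2) by (intro bexI[of _ p]) auto
    next
      \<comment> \<open>The first loss in round \<open>?r\<close> or later: the second disjunct of
        \<open>passed_inv\<close> is excluded, so every value is still at least \<open>?r\<close>,
        and \<open>exists_share\<close> supplies a new survivor holding the share that
        \<open>i\<close> misses.\<close>
      case False
      then have no_loser: "round_no (state c q) < ?r" if "q \<in> P" "\<not> live (state c q)" for q
        using that by force
      have full: "?r \<le> memory c x" if "x \<in> {1..m}" for x
      proof -
        obtain k where k: "x = f i k"
          using surjD[OF permutes_surj[OF f_permutes[OF i]], of x] by blast
        moreover have "k \<in> {1..m}"
          using that f_range[OF i, of k] k by blast
        ultimately show ?thesis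
          using lose(10) False inv i unfolding config_inv_def passed_inv_def by blast
      qed
      obtain w where w: "w \<in> P" "live (state c w)" "?r \<le> round_no (state c w)"
        "m \<le> counter (state c w) * (n + 1 - ?r)"
        using exists_share[OF inv r full no_loser] by auto
      have ai: "ahead (state c w) ?s" using w by (auto simp: ahead_def)
      have "w \<noteq> i" using w(4) lose by auto
      then have "state c' w = state c w" by (rule same)
      moreover have "ahead (state c w) (state c' q)" if "q \<in> P" "\<not> live (state c' q)" for q
      proof (cases "q = i")
        case True
        then show ?thesis using ai lose(2) by (simp add: ahead_def)
      next
        case False
        then show ?thesis using that no_loser[of q] w(3) same by (auto simp: ahead_def)
      qed
      ultimately show ?thesis
        unfolding survivor_inv_def using w(1,2) by (intro bexI[of _ w]) auto
    qed
  qed (intro keep; auto simp: ahead_def)+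
qed

lemma config_inv_step: "i \<in> P \<Longrightarrow> config_inv c \<Longrightarrow> step A f i c c' \<Longrightarrow> config_inv c'"
  unfolding config_inv_def[of c']
proof (intro conjI ballI)
  assume i: "i \<in> P" and inv: "config_inv c" and step: "step A f i c c'"
  show "local_inv n m d (state c' q)" if "q \<in> P" for q
    using that inv local_inv_step[OF i inv step] step_other[OF step, of q]
    by (cases "q = i") (simp_all add: config_inv_def)
qed (rule values_inv_step owners_inv_step passed_inv_step survivor_inv_step; assumption)+

section \<open>Termination\<close>

text \<open>
  \<open>Test j\<close> and \<open>Claim j\<close> have the same rank, so that every step increases the rank except for the
  two kinds of steps by which a process spins in the while loop.
\<close>

definition rank :: "local_state \<Rightarrow> nat" where
  "rank s = counter s + (case location s of
       Raise j \<Rightarrow> round_no s * (2 * m + 1) + j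
     | Test j \<Rightarrow> round_no s * (2 * m + 1) + m + j
     | Claim j \<Rightarrow> round_no s * (2 * m + 1) + m + j
     | Release j \<Rightarrow> (n + 1) * (2 * m + 1) + j
     | Returned v \<Rightarrow> (n + 2) * (2 * m + 1))"

lemma round_le: "local_inv n m d s \<Longrightarrow> round_no s \<le> n"
  using d_bounds by (auto simp: local_inv_def)

lemma rank_bound:
  assumes "local_inv n m d s"
  shows "rank s \<le> m + (n + 2) * (2 * m + 1)"
proof -
  have "counter s \<le> m"
    using assms card_mono[of "{1..m}" "{k. myview s k}"] by (auto simp: local_inv_def)
  moreover have "round_no s * (2 * m + 1) \<le> n * (2 * m + 1)"
    using round_le[OF assms] by (rule mult_le_mono1)
  ultimately show ?thesis
    using assms by (auto simp: rank_def local_inv_def location_inv_def split: location.splits)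
qed

lemma rank_step:
  assumes i: "i \<in> P" and inv: "config_inv c" and step: "step A f i c c'"
  obtains (progress) "rank (state c i) < rank (state c' i)"
  | (test) j where "rank (state c' i) = rank (state c i)" "memory c' = memory c"
      "location (state c i) = Test j" "location (state c' i) = Claim j"
      "round_no (state c' i) = round_no (state c i)" "memory c (f i j) < round_no (state c i)"
  | (claim) j where "rank (state c' i) = rank (state c i)" "memory c' = memory c"
      "location (state c i) = Claim j" "location (state c' i) = Test j"
      "round_no (state c' i) = round_no (state c i)" "memory c (f i j) \<noteq> 0"
proof -
  let ?s = "state c i"
  have linv: "local_inv n m d ?s" using i inv by (simp add: config_inv_def)
  have loc: "location_inv n m d ?s" using linv by (simp add: local_inv_def)
  have "round_no ?s * (2 * m + 1) \<le> n * (2 * m + 1)"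
    using round_le[OF linv] by (rule mult_le_mono1)
  \<comment> \<open>Offsets within a round run up to \<open>2 * m\<close>, so the weight
    \<open>2 * m + 1\<close> lets a new round dominate them; \<open>Release\<close> and
    \<open>Returned\<close> act as fictitious rounds \<open>n + 1\<close> and
    \<open>n + 2\<close>.\<close>
  then have bound: "round_no ?s * (2 * m + 1) + 2 * m < (n + 1) * (2 * m + 1)"
    by simp
  from linv step show thesis
  proof (cases rule: step_elim)
    case (raise j)
    have "rank ?s < rank (state c' i)"
      using raise loc
      by (cases rule: raise_from_cases[of m "j + 1" ?s]) (auto simp: rank_def location_inv_def)
    then show thesis by (rule progress)
  next
    case (test_fail j)
    then show thesis by (intro test[of j]) (auto simp: rank_def)
  next
    case (test_next j)
    then show thesis by (intro progress) (auto simp: rank_def)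
  next
    case lose
    have "rank ?s < rank (state c' i)"
      using lose bound
      by (cases rule: release_from_cases[of m 1 ?s]) (auto simp: rank_def)
    then show thesis by (rule progress)
  next
    case win
    then show thesis using bound by (intro progress) (auto simp: rank_def)
  next
    case advance
    have "rank ?s < rank (state c' i)"
      using advance
      by (cases rule: raise_from_cases[of m 1 "?s\<lparr>round_no := round_no ?s + 1\<rparr>"])
        (auto simp: rank_def)
    then show thesis by (rule progress)
  next
    case step_claim: (claim j)
    then show thesis by (intro progress) (auto simp: rank_def)
  next
    case (claim_fail j)
    then show thesis by (intro claim[of j]) (auto simp: rank_def)
  next
    case (release j)
    have "rank ?s < rank (state c' i)"
      using release loc
      by (cases rule: release_from_cases[of m "j + 1" ?s]) (auto simp: rank_def location_inv_def)
    then show thesis by (rule progress)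
  qed
qed

section \<open>Executions\<close>

lemma execution_step:
  assumes "execution A P f c s" "s t = Some i"
  shows "i \<in> P" "step A f i (c t) (c (Suc t))"
proof -
  have "case s t of Some i \<Rightarrow> i \<in> P \<and> step A f i (c t) (c (Suc t))
      | None \<Rightarrow> (\<forall>i\<in>P. returned A (c t) i) \<and> c (Suc t) = c t"
    using assms(1) unfolding execution_def by blast
  then show "i \<in> P" "step A f i (c t) (c (Suc t))" using assms(2) by simp_all
qed

lemma execution_idle:
  assumes "execution A P f c s" "s t = None"
  shows "c (Suc t) = c t"
proof -
  have "case s t of Some i \<Rightarrow> i \<in> P \<and> step A f i (c t) (c (Suc t))
      | None \<Rightarrow> (\<forall>i\<in>P. returned A (c t) i) \<and> c (Suc t) = c t"
    using assms(1) unfolding execution_def by blast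
  then show ?thesis using assms(2) by simp
qed

lemma execution_state_eq:
  assumes "execution A P f c s" "s t \<noteq> Some i"
  shows "state (c (Suc t)) i = state (c t) i"
proof (cases "s t")
  case None
  then show ?thesis using execution_idle[OF assms(1)] by simp
next
  case (Some q)
  then show ?thesis
    using assms(2) step_other[OF execution_step(2)[OF assms(1) Some], of i] by simp
qed

lemma config_inv_execution:
  assumes "execution A P f c s"
  shows "config_inv (c t)"
proof (induction t)
  case 0
  then show ?case using assms config_inv_initial by (simp add: execution_def)
next
  case (Suc t)
  then show ?case
    using assms execution_idle execution_step config_inv_step by (cases "s t") metis+
qed

lemma returned_iff: "returned A c i \<longleftrightarrow> (\<exists>v. location (state c i) = Returned v)"
  by (auto simp: returned_def election_algorithm_def election_action_def split: location.splits)

lemma elected_iff: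
  "elected A P c = {i \<in> P. \<exists>t. location (state (c t) i) = Returned Leader}"
proof -
  have "next_action A s = Return v \<longleftrightarrow> location s = Returned v" for s v
    by (auto simp: election_algorithm_def election_action_def split: location.splits)
  then show ?thesis by (simp add: elected_def)
qed

lemma returned_permanent:
  assumes ex: "execution A P f c s" and ret: "returned A (c t) i" and "t \<le> u"
  shows "state (c u) i = state (c t) i"
  using \<open>t \<le> u\<close>
proof (induction u rule: dec_induct)
  case (step u)
  then have "returned A (c u) i" using ret by (simp add: returned_def)
  then have "s u \<noteq> Some i"
    using execution_step(2)[OF ex, of u i] by (auto simp: returned_def step_def)
  then show ?case using execution_state_eq[OF ex] step by simp
qed simp

lemma next_step:
  assumes ex: "execution A P f c s" and i: "i \<in> P" and running: "\<not> returned A (c t) i"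
  obtains t' where "t \<le> t'" "s t' = Some i" "state (c t') i = state (c t) i"
proof -
  have "\<exists>t'\<ge>t. s t' = Some i"
    using ex i running by (simp add: execution_def)
  then obtain t' where t': "t \<le> t' \<and> s t' = Some i"
    and least: "\<And>u. t \<le> u \<and> s u = Some i \<Longrightarrow> t' \<le> u"
    using exists_least_iff[of "\<lambda>t'. t \<le> t' \<and> s t' = Some i"] by (metis not_le)
  have "u \<le> t' \<Longrightarrow> state (c u) i = state (c t) i" if "t \<le> u" for u
    using that
  proof (induction u rule: dec_induct)
    case (step u)
    then have "s u \<noteq> Some i" using least[of u] by auto
    then show ?case using execution_state_eq[OF ex] step by simp
  qed simp
  then show thesis using that t' by blast
qed

text \<open>The total rank is bounded and never decreases, hence is constant from some time on.
  After that only the two spinning steps occur, and the memory is frozen.\<close>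

lemma eventually_all_returned:
  assumes ex: "execution A P f c s"
  shows "\<exists>T. \<forall>i\<in>P. returned A (c T) i"
proof -
  define total where "total t = (\<Sum>p\<in>P. rank (state (c t) p))" for t
  note inv = config_inv_execution[OF ex]
  have rank_mono: "rank (state (c t) p) \<le> rank (state (c (Suc t)) p)" if "p \<in> P" for p t
  proof (cases "s t = Some p")
    case True
    show ?thesis
      using that inv execution_step(2)[OF ex True] by (cases rule: rank_step) auto
  qed (simp add: execution_state_eq[OF ex])
  have mono: "mono total"
    unfolding mono_iff_le_Suc total_def by (intro allI sum_mono rank_mono)
  have "total t < Suc (\<Sum>p\<in>P. m + (n + 2) * (2 * m + 1))" for t
    unfolding less_Suc_eq_le
    unfolding total_def using inv[of t] by (intro sum_mono rank_bound) (simp add: config_inv_def)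
  then obtain T where T: "total t \<le> total T" for t
    using ex_has_greatest_nat[of "\<lambda>_. True" 0 total] by blast
  have const: "rank (state (c (Suc t)) p) = rank (state (c t) p)" if "T \<le> t" "p \<in> P" for p t
  proof (rule ccontr)
    assume "\<not> ?thesis"
    then have "rank (state (c t) p) < rank (state (c (Suc t)) p)"
      using rank_mono[OF that(2), of t] by simp
    then have "total t < total (Suc t)"
      unfolding total_def using finite_P that(2) rank_mono
      by (intro sum_strict_mono_ex1) auto
    then show False
      using T[of "Suc t"] monoD[OF mono that(1)] by simp
  qed
  have memory: "memory (c t) = memory (c T)" if "T \<le> t" for t
    using that
  proof (induction t rule: dec_induct)
    case (step t)
    have "memory (c (Suc t)) = memory (c t)"
    proof (cases "s t")
      case None
      then show ?thesis using execution_idle[OF ex] by simp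
    next
      case (Some i)
      note i = execution_step[OF ex Some]
      from i(1) inv i(2) show ?thesis
        by (cases rule: rank_step) (use const[OF step(1) i(1)] in auto)
    qed
    then show ?case using step by simp
  qed simp
  define stuck where "stuck = {i \<in> P. \<not> returned A (c T) i}"
  \<comment> \<open>Two consecutive steps of a stuck process are a failed test and a failed claim in
    some order, both seeing the same frozen value.\<close>
  have blocked: "\<exists>j. location (state (c T) i) \<in> {Test j, Claim j} \<and>
      memory (c T) (f i j) \<noteq> 0 \<and> memory (c T) (f i j) < round_no (state (c T) i)"
    if "i \<in> stuck" for i
  proof -
    have i: "i \<in> P" "\<not> returned A (c T) i" using that by (auto simp: stuck_def)
    obtain t where t: "T \<le> t" "s t = Some i" "state (c t) i = state (c T) i"
      using next_step[OF ex i] by blast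
    have no_progress: "\<not> rank (state (c t) i) < rank (state (c (Suc t)) i)" if "T \<le> t" for t
      using const[OF that i(1)] by simp
    from i(1) inv execution_step(2)[OF ex t(2)] show ?thesis
    proof (cases rule: rank_step)
      case progress
      then show ?thesis using no_progress[OF t(1)] by simp
    next
      case (test j)
      then have "\<not> returned A (c (Suc t)) i" by (simp add: returned_iff)
      then obtain u where u: "Suc t \<le> u" "s u = Some i" "state (c u) i = state (c (Suc t)) i"
        using next_step[OF ex i(1)] by blast
      from i(1) inv execution_step(2)[OF ex u(2)] have "memory (c u) (f i j) \<noteq> 0"
        by (cases rule: rank_step) (use no_progress[of u] t u test(4) in auto)
      then show ?thesis using test t u memory[of t] memory[of u] by auto
    next
      case (claim j)
      then have "\<not> returned A (c (Suc t)) i" by (simp add: returned_iff)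
      then obtain u where u: "Suc t \<le> u" "s u = Some i" "state (c u) i = state (c (Suc t)) i"
        using next_step[OF ex i(1)] by blast
      from i(1) inv execution_step(2)[OF ex u(2)]
      have "memory (c u) (f i j) < round_no (state (c u) i)"
        by (cases rule: rank_step) (use no_progress[of u] t u claim(4) in auto)
      then show ?thesis using claim t u memory[of t] memory[of u] by auto
    qed
  qed
  have "stuck = {}"
  proof (rule ccontr)
    assume "stuck \<noteq> {}"
    then obtain i where i: "i \<in> stuck"
      "\<And>q. q \<in> stuck \<Longrightarrow> round_no (state (c T) i) \<le> round_no (state (c T) q)"
      using ex_has_least_nat[of "\<lambda>q. q \<in> stuck" _ "\<lambda>q. round_no (state (c T) q)"] by blast
    have iP: "i \<in> P" using i(1) by (simp add: stuck_def)
    have li: "local_inv n m d (state (c T) q)" if "q \<in> P" for q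
      using that inv[of T] by (simp add: config_inv_def)
    obtain j where j: "location (state (c T) i) \<in> {Test j, Claim j}"
      "memory (c T) (f i j) \<noteq> 0" "memory (c T) (f i j) < round_no (state (c T) i)"
      using blocked[OF i(1)] by blast
    have "f i j \<in> {1..m}"
      using j(1) li[OF iP] f_range[OF iP] by (auto simp: local_inv_def location_inv_def)
    then obtain p k where p: "p \<in> P" "k \<in> owned (state (c T) p)" "f p k = f i j"
      using inv[of T] j(2) unfolding config_inv_def owners_inv_def by metis
    \<comment> \<open>The owner has finished raising: if stuck it is at \<open>Test\<close> or
      \<open>Claim\<close>, otherwise it is a leader in the last round. So the register holds the
      owner's round, which is at least that of \<open>i\<close>.\<close>
    have "k \<notin> pending (state (c T) p) \<and> round_no (state (c T) i) \<le> round_no (state (c T) p)"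
    proof (cases "p \<in> stuck")
      case True
      then show ?thesis using i(2) blocked[OF True] by (auto simp: pending_def)
    next
      case False
      then obtain v where v: "location (state (c T) p) = Returned v"
        using p(1) by (auto simp: stuck_def returned_iff)
      then have "v = Leader" using p(2) by (simp add: owned_def)
      then show ?thesis
        using v li[OF p(1)] li[OF iP] by (auto simp: local_inv_def location_inv_def pending_def)
    qed
    then show False
      using owned_value(3)[OF inv p(1,2)] p(3) j(3) by simp
  qed
  then show ?thesis unfolding stuck_def by blast
qed

section \<open>Register names and the number of leaders\<close>

lemma register_name_range:
  assumes ex: "execution A P f c s" and i: "i \<in> P"
    and act: "next_action A (state (c t) i) = Invoke oper"
  shows "register_name oper \<in> {1..m}"
proof -
  have "location_inv n m d (state (c t) i)"
    using config_inv_execution[OF ex, of t] i by (simp add: config_inv_def local_inv_def)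
  then show ?thesis
    using act by (auto simp: election_algorithm_def election_action_def location_inv_def
        split: location.splits)
qed

text \<open>At a time \<open>T\<close> when all have returned, verdicts are final. The last check
  gives each leader at least \<open>m / d\<close> registers, so double counting bounds their number;
  the survivor, being live, must be a leader.\<close>

lemma card_elected:
  assumes ex: "execution A P f c s"
  shows "1 \<le> card (elected A P c)" "card (elected A P c) \<le> d"
proof -
  obtain T where T: "\<And>i. i \<in> P \<Longrightarrow> returned A (c T) i"
    using eventually_all_returned[OF ex] by blast
  note inv = config_inv_execution[OF ex, of T]
  have same: "location (state (c T) i) = Returned v"
    if "i \<in> P" "location (state (c t) i) = Returned v" for i t v
    using that T[OF that(1)] returned_permanent[OF ex, of t i T] returned_permanent[OF ex, of T i t]
      returned_iff by (metis nat_le_linear)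
  have elected: "elected A P c = {i \<in> P. location (state (c T) i) = Returned Leader}"
    unfolding elected_iff using same by blast
  have "card (elected A P c) \<le> d"
  proof (rule card_le_of_shares[OF inv])
    show "elected A P c \<subseteq> {p \<in> P. live (state (c T) p)}"
      by (auto simp: elected live_def)
    show "m \<le> counter (state (c T) p) * d" if "p \<in> elected A P c" for p
      using that inv by (auto simp: elected config_inv_def local_inv_def location_inv_def)
  qed
  then show "card (elected A P c) \<le> d" .
  obtain p where p: "p \<in> P" "live (state (c T) p)"
    using inv unfolding config_inv_def survivor_inv_def by blast
  then have "p \<in> elected A P c"
    using T[OF p(1)] by (auto simp: elected returned_iff live_def)
  moreover have "finite (elected A P c)" using finite_P by (simp add: elected_iff)
  ultimately show "1 \<le> card (elected A P c)"
    by (metis One_nat_def Suc_leI card_gt_0_iff empty_iff)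
qed

end

theorem theorem2:
  fixes n m d :: nat
  assumes "n \<ge> 2" and "m \<ge> 1" and "d \<in> {1..n - 1}" and "m \<in> M n d"
  shows "solves_d_election n m d (election_algorithm n m d)"
  unfolding solves_d_election_def
proof (intro allI impI, elim conjE)
  fix P f and c :: "nat \<Rightarrow> (local_state, nat) config" and s
  assume P: "P \<noteq> {}" "P \<subseteq> {1..n}" and f: "\<forall>i\<in>{1..n}. f i permutes {1..m}"
    and ex: "execution (election_algorithm n m d) P f c s"
  interpret election n m d P f
  proof
    show "f i permutes {1..m}" if "i \<in> P" for i using f P that by blast
  qed (use assms P in simp_all)
  from register_name_range[OF ex] eventually_all_returned[OF ex] card_elected[OF ex]
  show "(\<forall>i\<in>P. \<forall>t oper. next_action (election_algorithm n m d) (state (c t) i) = Invoke oper \<longrightarrow>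
          register_name oper \<in> {1..m}) \<and>
        (\<forall>i\<in>P. \<exists>t. returned (election_algorithm n m d) (c t) i) \<and>
        1 \<le> card (elected (election_algorithm n m d) P c) \<and>
        card (elected (election_algorithm n m d) P c) \<le> d"
    by blast
qed

end
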